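(* Let $d\ge 2$ and $n=3$. Let $f$ be a stable update function, let the interaction distribution $\mathcal D$ on $\Omega$ have full support, and let $\mathcal U^{(0)}$ be a configuration of three opinions in $\mathbb S^{d-1}$ which is not separable. Then $\mathcal U^{(t)}$ polarizes almost surely.
   Context: Model: fix integers $d,n\ge 2$. An opinion is a unit vector in $\mathbb R^d$; a configuration is an $n$-tuple $\mathcal U=(\vec u_1,\dots,\vec u_n)$ of opinions, and $A_{ij}:=\langle \vec u_i,\vec u_j\rangle$. An update function is a function $f:[-1,1]\to\mathbb R$. Let $\Omega=\{(i,j)\in[n]\times[n]: i\ne j\}$, $\mathcal D$ a probability distribution on $\Omega$ (full support: every element has positive probability), and $I^{(1)},I^{(2)},\dots$ i.i.d. with law $\mathcal D$. If the interaction at step $t$ is $(i,j)$ then $\vec u_k^{(t+1)}=\vec u_k^{(t)}$ for $k\ne i$ and $\vec u_i^{(t+1)}=\vec w/\|\vec w\|$ with $\vec w=\vec u_i^{(t)}+f(A_{ij}^{(t)})\,\vec u_j^{(t)}$. Polarized: for all $i,j$, $\vec u_i=\pm\vec u_j$; $\mathcal U^{(t)}$ polarizes if $\lim_{t\to\infty}\mathcal U^{(t)}$ exists and is polarized. $f$ is stable if it is continuous and $\operatorname{sign}(f(A))=\operatorname{sign}(A)$ for all $A\in[-1,1]$. Separable: $[n]$ can be partitioned into two nonempty sets $S,T$ with $\vec u_i\perp\vec u_j$ for all $i\in S,j\in T$. *)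

theory Defs
  imports "HOL-Analysis.Analysis" "HOL-Probability.Probability"
begin

definition stable_update :: "(real \<Rightarrow> real) \<Rightarrow> bool" where
  "stable_update f \<longleftrightarrow> continuous_on {-1..1} f \<and> (\<forall>A\<in>{-1..1}. sgn (f A) = sgn A)"

definition update ::
  "(real \<Rightarrow> real) \<Rightarrow> real^'d^'n \<Rightarrow> 'n \<times> 'n \<Rightarrow> real^'d^'n" where
  "update f U ij =
     (let i = fst ij; j = snd ij;
          w = U$i + f ((U$i) \<bullet> (U$j)) *\<^sub>R U$j
      in (\<chi> k. if k = i then w /\<^sub>R norm w else U$k))"

text \<open>Trajectory driven by the interaction sequence: the interaction at step t is
  the t-th element of the stream (i.e. I^(t+1) in the paper's numbering).\<close>
primrec traj ::
  "(real \<Rightarrow> real) \<Rightarrow> real^'d^'n \<Rightarrow> ('n \<times> 'n) stream \<Rightarrow> nat \<Rightarrow> real^'d^'n" where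
  "traj f U0 \<omega> 0 = U0"
| "traj f U0 \<omega> (Suc t) = update f (traj f U0 \<omega> t) (\<omega> !! t)"

definition is_config :: "real^'d^'n \<Rightarrow> bool" where
  "is_config U \<longleftrightarrow> (\<forall>i. norm (U$i) = 1)"

definition polarized :: "real^'d^'n \<Rightarrow> bool" where
  "polarized U \<longleftrightarrow> (\<forall>i j. U$i = U$j \<or> U$i = - U$j)"

definition polarizes :: "(nat \<Rightarrow> real^'d^'n) \<Rightarrow> bool" where
  "polarizes X \<longleftrightarrow> (\<exists>L. X \<longlonglongrightarrow> L \<and> polarized L)"

definition separable :: "real^'d^'n \<Rightarrow> bool" where
  "separable U \<longleftrightarrow> (\<exists>S T. S \<noteq> {} \<and> T \<noteq> {} \<and> S \<inter> T = {} \<and> S \<union> T = UNIV \<and>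
      (\<forall>i\<in>S. \<forall>j\<in>T. (U$i) \<bullet> (U$j) = 0))"

end

(*
  Let A_ij = <u_i, u_j> and S = |A_12| + |A_23| + |A_13|. One interaction satisfies
  S' >= min S (1 / (1 + max |f|)), so S stays bounded away from 0 along every trajectory and some
  |A_ij| >= delta holds at every time. For such a pair with |A_ik| <= |A_jk|, a number of
  consecutive interactions (i, j) depending only on delta drags u_i so close to the line of u_j that
  A_ik takes the sign making A_12 A_23 A_13 >= 0. Almost surely this happens at some time.
  From then on suitable signs s_i make all <s_i u_i, s_j u_j> nonnegative, and each update
  replaces s_i u_i by a normalised nonnegative combination of s_i u_i and s_j u_j. Hence every cap
  {x. <x, y> >= c} with c >= 0 that contains all s_i u_i keeps containing them, and the words
  (1,3)^K (2,3)^K push all of them into arbitrarily small caps around s_3 u_3.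
*)
theory Submission
  imports Defs
begin

section \<open>State-dependent words in an i.i.d. sequence\<close>

lemma prob_stream_space_finite:
  fixes D :: "'a::finite pmf"
  assumes "Measurable.pred (stream_space (measure_pmf D)) P"
  shows "\<P>(\<omega> in stream_space (measure_pmf D). P \<omega>)
       = (\<Sum>y\<in>UNIV. \<P>(\<omega> in stream_space (measure_pmf D). P (y ## \<omega>)) * pmf D y)"
proof -
  let ?p = "\<lambda>y. \<P>(\<omega> in stream_space (measure_pmf D). P (y ## \<omega>))"
  have "ennreal \<P>(\<omega> in stream_space (measure_pmf D). P \<omega>) = (\<integral>\<^sup>+y. ?p y \<partial>measure_pmf D)"
    using assms by (intro prob_space.prob_stream_space[OF prob_space_measure_pmf]) auto
  also have "\<dots> = ennreal (\<integral>y. ?p y \<partial>measure_pmf D)"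
    by (intro nn_integral_eq_integral integrable_measure_pmf_finite) auto
  also have "(\<integral>y. ?p y \<partial>measure_pmf D) = (\<Sum>y\<in>UNIV. ?p y * pmf D y)"
    by (intro integral_measure_pmf_real) auto
  finally show ?thesis
    by (simp add: sum_nonneg)
qed

lemma AE_stream_space_pmf_Cons:
  fixes D :: "'a::finite pmf"
  assumes "Measurable.pred (stream_space (measure_pmf D)) P"
    and "\<And>y. AE \<omega> in stream_space (measure_pmf D). P (y ## \<omega>)"
  shows "AE \<omega> in stream_space (measure_pmf D). P \<omega>"
  using assms by (subst prob_space.AE_stream_space[OF prob_space_measure_pmf]) auto

lemma pred_stream_space_stake:
  fixes D :: "'a::countable pmf"
  shows "Measurable.pred (stream_space (measure_pmf D)) (\<lambda>\<omega>. R (stake n \<omega>))"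
proof -
  have "stake n \<in> measurable (stream_space (measure_pmf D)) (count_space (UNIV :: 'a list set))"
    using measurable_stake[of n]
    by (subst measurable_cong_sets[OF sets_stream_space_cong[of _ "count_space UNIV"] refl]) auto
  then show ?thesis
    by (rule measurable_compose) simp
qed

text \<open>Only the first \<open>t + L\<close> letters matter, and words over a countable alphabet
  form a discrete space. So the event is measurable for arbitrary \<open>F\<close> and
  \<open>Q\<close> on a state type without measurable structure.\<close>

lemma pred_stream_space_word:
  fixes D :: "'a::countable pmf"
  shows "Measurable.pred (stream_space (measure_pmf D))
           (\<lambda>\<omega>. Q (foldl F s (stake t \<omega>)) (stake L (sdrop t \<omega>)))"
proof -
  have "Measurable.pred (stream_space (measure_pmf D))
      (\<lambda>\<omega>. Q (foldl F s (take t (stake (t + L) \<omega>))) (drop t (stake (t + L) \<omega>)))"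
    by (rule pred_stream_space_stake)
  then show ?thesis
    by (simp add: take_stake drop_stake)
qed

text \<open>The target word depends on the state reached so far. Its length, and hence the lower
  bound \<open>p ^ L\<close> for its probability, is the same for every state, so the worst failure
  probability over all starting states is at most a factor below 1 times itself.\<close>

lemma AE_state_word_occurs:
  fixes D :: "'a::finite pmf" and F :: "'s \<Rightarrow> 'a \<Rightarrow> 's" and W :: "'s \<Rightarrow> 'a list"
  assumes supp: "\<And>s. set (W s) \<subseteq> set_pmf D" and len: "\<And>s. length (W s) = L"
  shows "AE \<omega> in stream_space (measure_pmf D). \<exists>t. stake L (sdrop t \<omega>) = W (foldl F s (stake t \<omega>))"
proof -
  let ?M = "stream_space (measure_pmf D)"
  interpret S: prob_space ?M
    by (rule prob_space.prob_space_stream_space[OF prob_space_measure_pmf])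
  define bad where "bad s \<omega> \<longleftrightarrow> (\<forall>t. stake L (sdrop t \<omega>) \<noteq> W (foldl F s (stake t \<omega>)))" for s \<omega>
  have bad_meas[measurable]: "Measurable.pred ?M (bad s)" for s
    unfolding bad_def using pred_stream_space_word[of "\<lambda>s w. w \<noteq> W s" F s _ L D]
    by (intro pred_intros_countable) auto
  have bad_Cons: "bad (F s y) \<omega>" if "bad s (y ## \<omega>)" for s y \<omega>
    unfolding bad_def
  proof
    fix t show "stake L (sdrop t \<omega>) \<noteq> W (foldl F (F s y) (stake t \<omega>))"
      using that[unfolded bad_def, rule_format, of "Suc t"] by simp
  qed
  \<comment> \<open>Peeling off the letters of \<open>W s\<close> one by one gives \<open>e \<le> (1 - p ^ L) * e\<close>, hence \<open>e = 0\<close>.\<close>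
  define e where "e = (SUP s. \<P>(\<omega> in ?M. bad s \<omega>))"
  have bdd: "bdd_above (range (\<lambda>s. \<P>(\<omega> in ?M. bad s \<omega>)))"
    by (intro bdd_aboveI[of _ 1]) (auto intro: S.prob_le_1)
  have le_e: "\<P>(\<omega> in ?M. bad s \<omega>) \<le> e" for s
    unfolding e_def by (rule cSUP_upper[OF _ bdd]) simp
  have e0: "e \<ge> 0"
    using le_e[of s] measure_nonneg order_trans by blast
  define p where "p = Min (pmf D ` set_pmf D)"
  have ppos: "p > 0"
    unfolding p_def by (subst Min_gr_iff) (auto simp: set_pmf_not_empty pmf_positive)
  have p_le: "p \<le> pmf D x" if "x \<in> set_pmf D" for x
    unfolding p_def using that by (intro Min_le) auto
  \<comment> \<open>The avoided word \<open>w\<close> is decoupled from \<open>W s\<close>: the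
    induction shortens \<open>w\<close> while the state moves on to \<open>F s x\<close>. A first
    letter \<open>x\<close> leaves the tail of \<open>w\<close> to be avoided; for any other letter
    the trivial bound \<open>e\<close> is used.\<close>
  have word: "\<P>(\<omega> in ?M. stake (length w) \<omega> \<noteq> w \<and> bad s \<omega>) \<le> (1 - p ^ length w) * e"
    if "set w \<subseteq> set_pmf D" for w s
    using that
  proof (induction w arbitrary: s)
    case Nil
    then show ?case by simp
  next
    case (Cons x w)
    let ?B = "\<lambda>\<omega>. stake (length (x # w)) \<omega> \<noteq> x # w \<and> bad s \<omega>"
    let ?q = "1 - p ^ length w"
    have px: "p \<le> pmf D x"
      using Cons.prems by (intro p_le) auto
    have mB: "Measurable.pred ?M ?B"
      using pred_stream_space_stake[of "\<lambda>v. v \<noteq> x # w" "length (x # w)" D] by (intro pred_intros_logic) auto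
    have m1: "Measurable.pred ?M (\<lambda>\<omega>. stake (length w) \<omega> \<noteq> w \<and> bad s' \<omega>)" for s'
      using pred_stream_space_stake[of "\<lambda>v. v \<noteq> w" "length w" D] by (intro pred_intros_logic) auto
    have x: "\<P>(\<omega> in ?M. ?B (x ## \<omega>)) \<le> ?q * e"
    proof (rule order_trans[OF _ Cons.IH])
      show "\<P>(\<omega> in ?M. ?B (x ## \<omega>))
          \<le> \<P>(\<omega> in ?M. stake (length w) \<omega> \<noteq> w \<and> bad (F s x) \<omega>)"
        using m1 by (intro S.finite_measure_mono) (auto intro: bad_Cons)
    qed (use Cons.prems in auto)
    have y: "\<P>(\<omega> in ?M. ?B (y ## \<omega>)) \<le> e" for y
    proof (rule order_trans[OF _ le_e])
      show "\<P>(\<omega> in ?M. ?B (y ## \<omega>)) \<le> \<P>(\<omega> in ?M. bad (F s y) \<omega>)"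
        by (intro S.finite_measure_mono) (auto intro: bad_Cons)
    qed
    have "\<P>(\<omega> in ?M. ?B \<omega>) = (\<Sum>y\<in>UNIV. \<P>(\<omega> in ?M. ?B (y ## \<omega>)) * pmf D y)"
      by (rule prob_stream_space_finite[OF mB])
    also have "\<dots> \<le> (\<Sum>y\<in>UNIV. (if y = x then ?q * e else e) * pmf D y)"
    proof (intro sum_mono mult_right_mono)
      show "\<P>(\<omega> in ?M. ?B (y ## \<omega>)) \<le> (if y = x then ?q * e else e)" for y
        using x y[of y] by (cases "y = x") (simp_all only: if_True if_False simp_thms)
    qed simp
    also have "\<dots> = (\<Sum>y\<in>UNIV. e * pmf D y - (if y = x then p ^ length w * e * pmf D y else 0))"
      by (intro sum.cong) (auto simp: algebra_simps)
    also have "\<dots> = e - p ^ length w * e * pmf D x"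
      by (simp add: sum_subtractf sum_pmf_eq_1 flip: sum_distrib_left)
    also have "\<dots> \<le> e - p ^ length w * e * p"
      using px ppos e0 by (intro diff_left_mono mult_left_mono) auto
    finally show ?case
      by (simp add: algebra_simps)
  qed
  have "\<P>(\<omega> in ?M. bad s \<omega>) \<le> (1 - p ^ L) * e" for s
  proof -
    \<comment> \<open>At time 0, \<open>bad s\<close> already says that the initial word is not
      \<open>W s\<close>, so the extra condition is free.\<close>
    have "\<P>(\<omega> in ?M. bad s \<omega>) = \<P>(\<omega> in ?M. stake (length (W s)) \<omega> \<noteq> W s \<and> bad s \<omega>)"
      by (intro arg_cong2[where f = measure] refl Collect_cong)
         (auto simp: bad_def len dest: spec[of _ 0])
    also have "\<dots> \<le> (1 - p ^ L) * e"
      using word[of "W s" s] supp[of s] by (simp add: len)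
    finally show ?thesis .
  qed
  then have "e \<le> (1 - p ^ L) * e"
    unfolding e_def by (intro cSUP_least) (auto simp: e_def)
  then have "p ^ L * e \<le> 0"
    by (simp add: algebra_simps)
  then have "e = 0"
    using ppos e0 by (metis antisym mult_le_0_iff not_le zero_less_power)
  then have "\<P>(\<omega> in ?M. bad s \<omega>) = 0"
    using le_e[of s] by (metis antisym measure_nonneg)
  then have "AE \<omega> in ?M. \<not> bad s \<omega>"
    by (subst (asm) S.prob_Collect_eq_0) auto
  then show ?thesis
    by (simp add: bad_def)
qed

text \<open>Induction on \<open>T\<close> with the starting state arbitrary: after the first letter
  \<open>y\<close>, waiting until \<open>Suc T\<close> from \<open>s\<close> becomes waiting until
  \<open>T\<close> from \<open>F s y\<close>. Choosing one good word per state reduces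
  \<open>T = 0\<close> to a single occurrence.\<close>

lemma AE_state_word_frequently:
  fixes D :: "'a::finite pmf" and F :: "'s \<Rightarrow> 'a \<Rightarrow> 's"
  assumes "\<And>s. \<exists>w. set w \<subseteq> set_pmf D \<and> length w = L \<and> Q s w"
  shows "AE \<omega> in stream_space (measure_pmf D).
           \<forall>T. \<exists>t\<ge>T. Q (foldl F s (stake t \<omega>)) (stake L (sdrop t \<omega>))"
  unfolding AE_all_countable
proof
  fix T
  obtain W where W: "set (W s) \<subseteq> set_pmf D" "length (W s) = L" "Q s (W s)" for s
    using assms by metis
  show "AE \<omega> in stream_space (measure_pmf D).
          \<exists>t\<ge>T. Q (foldl F s (stake t \<omega>)) (stake L (sdrop t \<omega>))"
  proof (induction T arbitrary: s)
    case 0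
    show ?case
      using AE_state_word_occurs[of W, OF W(1,2), of F s] by eventually_elim (metis W(3) zero_le)
  next
    case (Suc T)
    show ?case
    proof (rule AE_stream_space_pmf_Cons)
      show "Measurable.pred (stream_space (measure_pmf D))
              (\<lambda>\<omega>. \<exists>t\<ge>Suc T. Q (foldl F s (stake t \<omega>)) (stake L (sdrop t \<omega>)))"
        using pred_stream_space_word[of Q F s _ L D]
        by (intro pred_intros_countable pred_intros_logic) auto
      show "AE \<omega> in stream_space (measure_pmf D).
              \<exists>t\<ge>Suc T. Q (foldl F s (stake t (y ## \<omega>))) (stake L (sdrop t (y ## \<omega>)))" for y
        using Suc.IH[of "F s y"]
      proof eventually_elim
        case (elim \<omega>)
        then obtain t where "t \<ge> T" "Q (foldl F (F s y) (stake t \<omega>)) (stake L (sdrop t \<omega>))"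
          by blast
        then show ?case
          by (intro exI[of _ "Suc t"]) auto
      qed
    qed
  qed
qed

section \<open>A single interaction\<close>

lemma update_nth_other:
  assumes "k \<noteq> i"
  shows "update f U (i, j) $ k = U $ k"
  using assms by (simp add: update_def Let_def)

lemma abs_inner_config_le_1:
  assumes "is_config U"
  shows "\<bar>U $ i \<bullet> U $ j\<bar> \<le> 1"
  using assms Cauchy_Schwarz_ineq2[of "U $ i" "U $ j"] by (simp add: is_config_def)

lemma inner_config_self:
  assumes "is_config U"
  shows "U $ i \<bullet> U $ i = 1"
  using assms by (simp add: is_config_def norm_eq_1)

lemma sgn_stable_update:
  assumes "stable_update f" "is_config U"
  shows "sgn (f (U $ i \<bullet> U $ j)) = sgn (U $ i \<bullet> U $ j)"
  using assms abs_inner_config_le_1[OF assms(2), of i j] by (auto simp: stable_update_def abs_le_iff)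

text \<open>\<open>N\<close> is the norm before normalisation. Its square is
  \<open>1 + 2 * (f a * a) + (f a)^2\<close> with \<open>a\<close> the inner product, and stability
  makes \<open>f a * a\<close> nonnegative, so \<open>N\<close> is at least 1; the upper bound is
  the triangle inequality.\<close>

lemma update_nth_self:
  fixes U :: "real^'d^'n"
  assumes "stable_update f" "is_config U"
  obtains N where "1 \<le> N" "N \<le> 1 + \<bar>f (U $ i \<bullet> U $ j)\<bar>"
    "update f U (i, j) $ i = (U $ i + f (U $ i \<bullet> U $ j) *\<^sub>R U $ j) /\<^sub>R N"
    "norm (update f U (i, j) $ i) = 1"
proof -
  let ?a = "U $ i \<bullet> U $ j"
  let ?w = "U $ i + f ?a *\<^sub>R U $ j"
  have "f ?a * ?a \<ge> 0"
    using sgn_stable_update[OF assms, of i j] by (auto simp: sgn_if zero_le_mult_iff split: if_splits)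
  moreover have "(norm ?w)\<^sup>2 = 1 + 2 * (f ?a * ?a) + (f ?a)\<^sup>2"
    unfolding power2_norm_eq_inner using inner_config_self[OF assms(2)]
    by (simp add: inner_add inner_commute[of "U $ j" "U $ i"] power2_eq_square algebra_simps)
  ultimately have "1\<^sup>2 \<le> (norm ?w)\<^sup>2"
    by simp
  then have "1 \<le> norm ?w"
    by (rule power2_le_imp_le) simp
  moreover have "norm ?w \<le> 1 + \<bar>f ?a\<bar>"
    using norm_triangle_ineq[of "U $ i" "f ?a *\<^sub>R U $ j"] assms(2) by (simp add: is_config_def)
  moreover have upd: "update f U (i, j) $ i = ?w /\<^sub>R norm ?w"
    by (simp add: update_def Let_def)
  moreover have "norm ?w \<noteq> 0"
    using \<open>1 \<le> norm ?w\<close> by linarith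
  then have "norm (?w /\<^sub>R norm ?w) = 1"
    by (simp only: norm_scaleR abs_inverse abs_norm_cancel left_inverse simp_thms)
  then have "norm (update f U (i, j) $ i) = 1"
    using upd by (simp only:)
  ultimately show thesis
    using that by blast
qed

lemma is_config_update:
  assumes "stable_update f" "is_config U"
  shows "is_config (update f U p)"
  unfolding is_config_def
proof
  fix k
  obtain i j where p: "p = (i, j)" by (cases p)
  show "norm (update f U p $ k) = 1"
  proof (cases "k = i")
    case True
    then show ?thesis
      using update_nth_self[OF assms, of i j] p by metis
  next
    case False
    then show ?thesis
      using assms(2) by (simp add: p update_nth_other is_config_def)
  qed
qed

lemma is_config_foldl_update:
  assumes "stable_update f" "is_config U"
  shows "is_config (foldl (update f) U w)"
  using assms(2) by (induction w arbitrary: U) (auto intro: is_config_update assms(1))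

text \<open>Since \<open>a\<close> and \<open>f a\<close> share a sign, the new inner product has
  absolute value \<open>(|a| + |f a|) / N\<close>. With \<open>N\<close> at most
  \<open>1 + |f a|\<close> and \<open>|a|\<close> at most 1, this is at least
  \<open>|a|\<close>.\<close>

lemma update_inner_self:
  assumes "stable_update f" "is_config U" "i \<noteq> j"
  shows "sgn (update f U (i, j) $ i \<bullet> U $ j) = sgn (U $ i \<bullet> U $ j)"
    and "\<bar>U $ i \<bullet> U $ j\<bar> \<le> \<bar>update f U (i, j) $ i \<bullet> U $ j\<bar>"
proof -
  let ?a = "U $ i \<bullet> U $ j"
  obtain N where N: "1 \<le> N" "N \<le> 1 + \<bar>f ?a\<bar>"
    "update f U (i, j) $ i = (U $ i + f ?a *\<^sub>R U $ j) /\<^sub>R N"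
    using update_nth_self[OF assms(1,2)] by metis
  have eq: "update f U (i, j) $ i \<bullet> U $ j = (?a + f ?a) / N"
    using inner_config_self[OF assms(2), of j] by (simp add: N(3) inner_add divide_inverse)
  have sg: "sgn (f ?a) = sgn ?a"
    by (rule sgn_stable_update[OF assms(1,2)])
  then have abs_add: "\<bar>?a + f ?a\<bar> = \<bar>?a\<bar> + \<bar>f ?a\<bar>" and "sgn (?a + f ?a) = sgn ?a"
    by (auto simp: sgn_if abs_if split: if_splits)
  then show "sgn (update f U (i, j) $ i \<bullet> U $ j) = sgn ?a"
    using N(1) by (simp add: eq sgn_divide)
  have "\<bar>?a\<bar> * N \<le> \<bar>?a\<bar> * (1 + \<bar>f ?a\<bar>)"
    using N(2) by (intro mult_left_mono) auto
  also have "\<dots> \<le> \<bar>?a\<bar> + \<bar>f ?a\<bar>"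
    using abs_inner_config_le_1[OF assms(2), of i j] mult_right_mono[of "\<bar>?a\<bar>" 1 "\<bar>f ?a\<bar>"]
    by (simp add: algebra_simps)
  finally show "\<bar>?a\<bar> \<le> \<bar>update f U (i, j) $ i \<bullet> U $ j\<bar>"
    using N(1) by (simp add: eq abs_add pos_le_divide_eq)
qed

text \<open>Opinion \<open>i\<close> stays in the span of the two initial vectors. Each step adds at
  least \<open>\<phi>\<close> to \<open>y\<close> before both coefficients are divided by the same
  \<open>N\<close>, and \<open>x\<close> never exceeds 1, so the ratio of \<open>y\<close> to
  \<open>x\<close> gains at least \<open>\<phi>\<close>. The overlap never drops below
  \<open>\<delta>\<close>, which keeps the bound on \<open>f\<close> applicable.\<close>

lemma foldl_update_replicate:
  fixes U :: "real^'d^'n"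
  assumes f: "stable_update f" and U: "is_config U" and "i \<noteq> j"
    and \<phi>: "\<And>z. z \<in> {-1..1} \<Longrightarrow> \<delta> \<le> \<bar>z\<bar> \<Longrightarrow> \<phi> \<le> \<bar>f z\<bar>"
    and \<delta>: "0 < \<delta>" "\<delta> \<le> \<bar>U $ i \<bullet> U $ j\<bar>" and "0 \<le> \<phi>"
  defines "V \<equiv> \<lambda>k. foldl (update f) U (replicate k (i, j))"
  shows "(\<forall>l. l \<noteq> i \<longrightarrow> V k $ l = U $ l) \<and>
    sgn (V k $ i \<bullet> U $ j) = sgn (U $ i \<bullet> U $ j) \<and> \<delta> \<le> \<bar>V k $ i \<bullet> U $ j\<bar> \<and>
    (\<exists>x y. 0 < x \<and> x \<le> 1 \<and> real k * \<phi> * x \<le> y \<and>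
       V k $ i = x *\<^sub>R U $ i + (y * sgn (U $ i \<bullet> U $ j)) *\<^sub>R U $ j)"
proof (induction k)
  case 0
  show ?case
  proof -
    have "\<exists>x y. 0 < x \<and> x \<le> 1 \<and> real 0 * \<phi> * x \<le> y \<and>
       U $ i = x *\<^sub>R U $ i + (y * sgn (U $ i \<bullet> U $ j)) *\<^sub>R U $ j"
      by (rule exI[of _ 1], rule exI[of _ 0]) simp
    then show ?thesis
      using \<delta> by (simp add: V_def)
  qed
next
  case (Suc k)
  let ?\<sigma> = "sgn (U $ i \<bullet> U $ j)" and ?b = "V k $ i \<bullet> V k $ j"
  have V_Suc: "V (Suc k) = update f (V k) (i, j)"
    by (simp add: V_def flip: replicate_append_same)
  have V: "is_config (V k)"
    unfolding V_def by (rule is_config_foldl_update[OF f U])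
  from Suc obtain x y where xy: "0 < x" "x \<le> 1" "real k * \<phi> * x \<le> y"
    "V k $ i = x *\<^sub>R U $ i + (y * ?\<sigma>) *\<^sub>R U $ j"
    by blast
  have Vj: "V k $ j = U $ j"
    using Suc \<open>i \<noteq> j\<close> by auto
  have b: "sgn ?b = ?\<sigma>" "\<delta> \<le> \<bar>?b\<bar>"
    using Suc by (auto simp: Vj)
  obtain q where q: "f ?b = q * ?\<sigma>" "\<phi> \<le> q" "0 \<le> q"
  proof (rule that[of "\<bar>f ?b\<bar>"])
    show "f ?b = \<bar>f ?b\<bar> * ?\<sigma>"
      using sgn_stable_update[OF f V, of i j] b(1) by (metis abs_mult_sgn)
    show "\<phi> \<le> \<bar>f ?b\<bar>"
      using abs_inner_config_le_1[OF V, of i j] b(2) by (intro \<phi>) (auto simp: abs_le_iff)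
  qed simp
  obtain N where N: "1 \<le> N" "update f (V k) (i, j) $ i = (V k $ i + f ?b *\<^sub>R V k $ j) /\<^sub>R N"
    using update_nth_self[OF f V] by metis
  have "V (Suc k) $ i = (x *\<^sub>R U $ i + (y * ?\<sigma>) *\<^sub>R U $ j + (q * ?\<sigma>) *\<^sub>R U $ j) /\<^sub>R N"
    by (simp only: V_Suc N(2) q(1)) (simp only: xy(4) Vj)
  also have "\<dots> = (x / N) *\<^sub>R U $ i + ((y + q) / N * ?\<sigma>) *\<^sub>R U $ j"
    by (simp add: algebra_simps divide_inverse)
  finally have "V (Suc k) $ i = (x / N) *\<^sub>R U $ i + ((y + q) / N * ?\<sigma>) *\<^sub>R U $ j" .
  moreover have "0 < x / N" "x / N \<le> 1"
    using xy N by (auto simp: divide_le_eq)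
  moreover have "real (Suc k) * \<phi> * (x / N) \<le> (y + q) / N"
  proof -
    have "\<phi> * x \<le> \<phi> * 1"
      using xy \<open>0 \<le> \<phi>\<close> by (intro mult_left_mono) auto
    then have "real (Suc k) * \<phi> * x \<le> y + q"
      using xy(3) q(2) by (simp add: algebra_simps)
    then have "real (Suc k) * \<phi> * x / N \<le> (y + q) / N"
      using N(1) by (intro divide_right_mono) auto
    then show ?thesis by simp
  qed
  moreover have "sgn (V (Suc k) $ i \<bullet> U $ j) = ?\<sigma>" "\<delta> \<le> \<bar>V (Suc k) $ i \<bullet> U $ j\<bar>"
    using update_inner_self[OF f V \<open>i \<noteq> j\<close>] b by (auto simp: V_Suc Vj)
  moreover have "V (Suc k) $ l = U $ l" if "l \<noteq> i" for l
    using Suc that by (simp add: V_Suc update_nth_other)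
  ultimately show ?case
    by blast
qed

section \<open>Bounds on the size of \<open>f\<close> from compactness\<close>

lemma stable_update_bounded_below:
  assumes "stable_update f" "0 < \<delta>"
  obtains \<phi> where "0 < \<phi>" "\<And>z. z \<in> {-1..1} \<Longrightarrow> \<delta> \<le> \<bar>z\<bar> \<Longrightarrow> \<phi> \<le> \<bar>f z\<bar>"
proof -
  let ?C = "{-1..1} \<inter> {z::real. \<delta> \<le> \<bar>z\<bar>}"
  have "closed {z::real. \<delta> \<le> \<bar>z\<bar>}"
    by (intro closed_Collect_le continuous_intros)
  then have C: "compact ?C"
    by (intro compact_Int_closed compact_Icc)
  have cont: "continuous_on ?C (\<lambda>z. \<bar>f z\<bar>)"
    using assms(1) by (auto simp: stable_update_def intro!: continuous_intros elim: continuous_on_subset)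
  show thesis
  proof (cases "?C = {}")
    \<comment> \<open>This happens when \<open>\<delta>\<close> exceeds 1; the bound is then vacuous
      and any positive number serves.\<close>
    case True
    then show thesis
      by (intro that[of 1]) auto
  next
    case False
    then obtain c where c: "c \<in> ?C" "\<And>z. z \<in> ?C \<Longrightarrow> \<bar>f c\<bar> \<le> \<bar>f z\<bar>"
      using continuous_attains_inf[OF C _ cont] by blast
    moreover from c(1) assms have "f c \<noteq> 0"
      unfolding stable_update_def by (metis IntD1 IntD2 abs_zero mem_Collect_eq not_le sgn_0_0)
    ultimately show thesis
      by (intro that[of "\<bar>f c\<bar>"]) auto
  qed
qed

lemma stable_update_bounded_above:
  assumes "stable_update f"
  obtains B where "0 \<le> B" "\<And>z. z \<in> {-1..1} \<Longrightarrow> \<bar>f z\<bar> \<le> B"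
proof -
  have "compact (f ` {-1..1})"
    using assms by (intro compact_continuous_image) (auto simp: stable_update_def)
  then obtain B where "\<forall>y\<in>f ` {-1..1}. norm y \<le> B"
    using compact_imp_bounded bounded_iff by blast
  then show thesis
    by (intro that[of "max 0 B"]) (auto simp: le_max_iff_disj)
qed

section \<open>Signs that turn all inner products nonnegative, and invariant caps\<close>

definition same_side :: "('n \<Rightarrow> real) \<Rightarrow> real^'d^'n \<Rightarrow> bool" where
  "same_side s U \<longleftrightarrow> (\<forall>i j. 0 \<le> (s i *\<^sub>R U $ i) \<bullet> (s j *\<^sub>R U $ j))"

text \<open>On a common side, \<open>s i * f a\<close> equals \<open>|f a| * s j\<close>, so the
  flipped opinion becomes a combination of flipped opinions with weights 1 and \<open>|f a|\<close>.
  Their sum is at least the normaliser \<open>N\<close>, so division by \<open>N\<close> keeps the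
  bound \<open>c\<close>.\<close>

lemma same_side_update_ge:
  assumes f: "stable_update f" and U: "is_config U"
    and s: "\<And>i. \<bar>s i\<bar> = 1" and "same_side s U"
    and c: "0 \<le> c" "\<And>i. c \<le> (s i *\<^sub>R U $ i) \<bullet> y"
  shows "c \<le> (s k *\<^sub>R update f U p $ k) \<bullet> y"
proof -
  obtain i j where p: "p = (i, j)" by (cases p)
  show ?thesis
  proof (cases "k = i")
    case False
    then show ?thesis
      using c(2)[of k] by (simp add: p update_nth_other)
  next
    case True
    let ?a = "U $ i \<bullet> U $ j"
    obtain N where N: "1 \<le> N" "N \<le> 1 + \<bar>f ?a\<bar>"
      "update f U (i, j) $ i = (U $ i + f ?a *\<^sub>R U $ j) /\<^sub>R N"
      using update_nth_self[OF f U] by metis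
    have ss: "s i * s i = 1" "s j * s j = 1"
      using s by (metis abs_mult_self_eq mult_1)+
    have "0 \<le> s i * s j * ?a"
      using assms(4) by (auto simp: same_side_def algebra_simps)
    then have "0 \<le> sgn (s i * s j * ?a)"
      by simp
    also have "sgn (s i * s j * ?a) = sgn (s i * s j * f ?a)"
      using sgn_stable_update[OF f U, of i j] by (simp add: sgn_mult)
    finally have "0 \<le> s i * s j * f ?a"
      by simp
    then have "s i * s j * f ?a = \<bar>f ?a\<bar>"
      using s by (metis abs_mult abs_of_nonneg mult_1)
    then have "s i * f ?a = \<bar>f ?a\<bar> * s j"
      using ss(2) by (metis mult.assoc mult.commute mult_1)
    then have "(s i *\<^sub>R (U $ i + f ?a *\<^sub>R U $ j)) \<bullet> y
        = (s i *\<^sub>R U $ i) \<bullet> y + \<bar>f ?a\<bar> * ((s j *\<^sub>R U $ j) \<bullet> y)"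
      by (simp add: inner_add distrib_left flip: mult.assoc)
    also have "\<dots> \<ge> c + \<bar>f ?a\<bar> * c"
      using c(2) by (intro add_mono mult_left_mono) auto
    \<comment> \<open>Nonnegativity of \<open>c\<close> enters here: for a negative
      \<open>c\<close>, replacing the weight \<open>1 + |f a|\<close> by the smaller
      \<open>N\<close> would go the wrong way.\<close>
    also have "c + \<bar>f ?a\<bar> * c \<ge> c * N"
      using N(2) c(1) mult_left_mono[of N "1 + \<bar>f ?a\<bar>" c] by (simp add: algebra_simps)
    finally have "c * N \<le> (s i *\<^sub>R (U $ i + f ?a *\<^sub>R U $ j)) \<bullet> y" .
    then have "c \<le> ((s i *\<^sub>R (U $ i + f ?a *\<^sub>R U $ j)) \<bullet> y) / N"
      using N(1) by (subst pos_le_divide_eq) auto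
    also have "\<dots> = (s k *\<^sub>R update f U p $ k) \<bullet> y"
      unfolding True p N(3) inner_scaleR_left by (simp add: divide_inverse)
    finally show ?thesis .
  qed
qed

text \<open>The cap bound is applied with each old flipped opinion as centre. Only the updated
  opinion paired with itself escapes this; there the product is 1, and \<open>m\<close> is at most
  1. The case \<open>m = 0\<close> says that \<open>same_side\<close> persists.\<close>

lemma same_side_update_inner_ge:
  assumes f: "stable_update f" and U: "is_config U" and s: "\<And>i. \<bar>s i\<bar> = 1"
    and m: "0 \<le> m" "\<And>i j. m \<le> (s i *\<^sub>R U $ i) \<bullet> (s j *\<^sub>R U $ j)"
  shows "m \<le> (s k *\<^sub>R update f U p $ k) \<bullet> (s l *\<^sub>R update f U p $ l)"
proof -
  obtain i j where p: "p = (i, j)" by (cases p)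
  have side: "same_side s U"
    unfolding same_side_def using m order_trans by blast
  have ss: "s i * s i = 1" for i
    using s by (metis abs_mult_self_eq mult_1)
  have mixed: "m \<le> (s k *\<^sub>R update f U p $ k) \<bullet> (s l *\<^sub>R U $ l)" for k l
    by (rule same_side_update_ge[OF f U s side m(1)]) (rule m(2))
  show ?thesis
  proof (cases "l = i")
    case False
    then show ?thesis
      using mixed[of k l] by (simp add: p update_nth_other)
  next
    case l: True
    show ?thesis
    proof (cases "k = i")
      case False
      then show ?thesis
        using mixed[of l k] by (simp add: p update_nth_other inner_commute)
    next
      case True
      have "m \<le> 1"
        using m(2)[of i i] ss[of i] inner_config_self[OF U, of i] by (simp flip: mult.assoc)
      then show ?thesis
        using ss[of i] inner_config_self[OF is_config_update[OF f U], of p i] True l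
        by (simp flip: mult.assoc)
    qed
  qed
qed

section \<open>Three opinions\<close>

lemma exhaust_3_distinct:
  fixes i j k l :: 3
  assumes "i \<noteq> j" "j \<noteq> k" "i \<noteq> k"
  shows "l = i \<or> l = j \<or> l = k"
  using assms exhaust_3[of i] exhaust_3[of j] exhaust_3[of k] exhaust_3[of l] by auto

lemma ex_third:
  fixes i j :: 3
  obtains k where "k \<noteq> i" "k \<noteq> j"
  using exhaust_3[of i] exhaust_3[of j] that[of 1] that[of 2] that[of 3] by auto

section \<open>Invariants of three opinions and the sign of the triple product\<close>

definition overlap :: "real^'d^3 \<Rightarrow> real" where
  "overlap U = \<bar>U $ 1 \<bullet> U $ 2\<bar> + \<bar>U $ 2 \<bullet> U $ 3\<bar> + \<bar>U $ 1 \<bullet> U $ 3\<bar>"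

text \<open>Each opinion enters exactly two factors, so replacing an opinion by its negative leaves
  the product unchanged.\<close>

definition triple :: "real^'d^3 \<Rightarrow> real" where
  "triple U = (U $ 1 \<bullet> U $ 2) * (U $ 2 \<bullet> U $ 3) * (U $ 1 \<bullet> U $ 3)"

text \<open>For three unit vectors this is equivalent to not being separable.\<close>

definition linked :: "real^'d^'n \<Rightarrow> bool" where
  "linked U \<longleftrightarrow> (\<exists>i. \<forall>j. U $ i \<bullet> U $ j \<noteq> 0)"

lemma overlap_eq:
  assumes "i \<noteq> j" "j \<noteq> k" "i \<noteq> k"
  shows "overlap U = \<bar>U $ i \<bullet> U $ j\<bar> + \<bar>U $ j \<bullet> U $ k\<bar> + \<bar>U $ i \<bullet> U $ k\<bar>"
  using assms exhaust_3[of i] exhaust_3[of j] exhaust_3[of k]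
  by (auto simp: overlap_def inner_commute)

lemma triple_eq:
  assumes "i \<noteq> j" "j \<noteq> k" "i \<noteq> k"
  shows "triple U = (U $ i \<bullet> U $ j) * (U $ j \<bullet> U $ k) * (U $ i \<bullet> U $ k)"
  using assms exhaust_3[of i] exhaust_3[of j] exhaust_3[of k]
  by (auto simp: triple_def inner_commute)

text \<open>Pairs \<open>(i, i)\<close> carry no mass under \<open>D\<close> in the theorem, but the
  one-step invariants are stated for every pair. Here the opinion is only scaled by
  \<open>1 + f 1\<close>, which normalisation undoes.\<close>

lemma update_diag:
  assumes "stable_update f" "is_config U"
  shows "update f U (i, i) = U"
proof -
  have "sgn (f 1) = 1"
    using assms(1) by (auto simp: stable_update_def)
  then have f1: "0 < f 1"
    by (simp add: sgn_1_pos)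
  have "U $ i + f 1 *\<^sub>R U $ i = (1 + f 1) *\<^sub>R U $ i"
    by (simp add: scaleR_add_left)
  moreover have "norm ((1 + f 1) *\<^sub>R U $ i) = 1 + f 1"
    using f1 assms(2) by (simp add: is_config_def)
  ultimately have "(U $ i + f 1 *\<^sub>R U $ i) /\<^sub>R norm (U $ i + f 1 *\<^sub>R U $ i) = U $ i"
    using f1 by simp
  then show ?thesis
    unfolding update_def Let_def fst_conv snd_conv inner_config_self[OF assms(2)]
    by (subst vec_eq_iff) (simp only: vec_lambda_beta split: if_split, simp)
qed

text \<open>Write \<open>a\<close>, \<open>b\<close>, \<open>c\<close> for the absolute inner
  products of the pairs \<open>(i, j)\<close>, \<open>(j, k)\<close>, \<open>(i, k)\<close> and
  \<open>\<phi>\<close> for the size of \<open>f\<close> at the first. The new sum is at least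
  \<open>b + (a + c + \<phi> * (1 - b)) / N\<close>. If the old sum is at most 1, then
  \<open>a + c\<close> is at most \<open>1 - b\<close>, and \<open>N \<le> 1 + \<phi>\<close> shows
  that the sum does not drop. Otherwise the bound is at least \<open>1 / N\<close>.\<close>

lemma overlap_update_ge:
  fixes U :: "real^'d^3"
  assumes f: "stable_update f" and U: "is_config U"
    and B: "\<And>z. z \<in> {-1..1} \<Longrightarrow> \<bar>f z\<bar> \<le> B"
  shows "min (overlap U) (1 / (1 + B)) \<le> overlap (update f U p)"
proof -
  obtain i j where p: "p = (i, j)" by (cases p)
  show ?thesis
  proof (cases "i = j")
    case True
    then show ?thesis
      using update_diag[OF f U] p by simp
  next
    case False
    obtain k where k: "k \<noteq> i" "k \<noteq> j" by (rule ex_third)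
    let ?U = "update f U (i, j)" and ?a = "U $ i \<bullet> U $ j"
    let ?b = "\<bar>U $ j \<bullet> U $ k\<bar>" and ?c = "\<bar>U $ i \<bullet> U $ k\<bar>" and ?\<phi> = "\<bar>f ?a\<bar>"
    obtain N where N: "1 \<le> N" "N \<le> 1 + ?\<phi>" "?U $ i = (U $ i + f ?a *\<^sub>R U $ j) /\<^sub>R N"
      using update_nth_self[OF f U] by metis
    have other: "?U $ j = U $ j" "?U $ k = U $ k"
      using False k by (auto simp: update_nth_other)
    have "?U $ i \<bullet> U $ j = (?a + f ?a) / N"
      using inner_config_self[OF U, of j] by (simp add: N(3) inner_add divide_inverse)
    moreover have "\<bar>?a + f ?a\<bar> = \<bar>?a\<bar> + ?\<phi>"
      using sgn_stable_update[OF f U, of i j] by (auto simp: sgn_if abs_if split: if_splits)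
    ultimately have ij: "\<bar>?U $ i \<bullet> U $ j\<bar> = (\<bar>?a\<bar> + ?\<phi>) / N"
      using N(1) by (simp add: abs_divide)
    have "?U $ i \<bullet> U $ k = (U $ i \<bullet> U $ k + f ?a * (U $ j \<bullet> U $ k)) / N"
      by (simp add: N(3) inner_add divide_inverse)
    moreover have "?c - ?\<phi> * ?b \<le> \<bar>U $ i \<bullet> U $ k + f ?a * (U $ j \<bullet> U $ k)\<bar>"
      unfolding abs_mult[symmetric] by linarith
    ultimately have ik: "(?c - ?\<phi> * ?b) / N \<le> \<bar>?U $ i \<bullet> U $ k\<bar>"
      using N(1) by (simp add: abs_divide divide_right_mono)
    have "overlap ?U = \<bar>?U $ i \<bullet> U $ j\<bar> + ?b + \<bar>?U $ i \<bullet> U $ k\<bar>"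
      using overlap_eq[of i j k ?U] False k by (simp add: other)
    also have "\<dots> \<ge> (\<bar>?a\<bar> + ?\<phi>) / N + ?b + (?c - ?\<phi> * ?b) / N"
      using ij ik by simp
    finally have S': "?b + (\<bar>?a\<bar> + ?c + ?\<phi> * (1 - ?b)) / N \<le> overlap ?U"
      by (simp add: algebra_simps add_divide_distrib diff_divide_distrib)
    have S: "overlap U = \<bar>?a\<bar> + ?b + ?c"
      using overlap_eq[of i j k U] False k by simp
    have b1: "?b \<le> 1"
      by (rule abs_inner_config_le_1[OF U])
    have "min (overlap U) (1 / (1 + B)) \<le> ?b + (\<bar>?a\<bar> + ?c + ?\<phi> * (1 - ?b)) / N"
    proof (cases "overlap U \<le> 1")
      case True
      have "(\<bar>?a\<bar> + ?c) * N \<le> (\<bar>?a\<bar> + ?c) * (1 + ?\<phi>)"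
        using N(2) by (intro mult_left_mono) auto
      also have "\<dots> \<le> \<bar>?a\<bar> + ?c + ?\<phi> * (1 - ?b)"
        using True S mult_left_mono[of "\<bar>?a\<bar> + ?c" "1 - ?b" ?\<phi>] by (simp add: algebra_simps)
      finally have "\<bar>?a\<bar> + ?c \<le> (\<bar>?a\<bar> + ?c + ?\<phi> * (1 - ?b)) / N"
        using N(1) by (simp add: pos_le_divide_eq)
      then show ?thesis
        unfolding S by (intro min.coboundedI1) linarith
    next
      case False
      have NB: "N \<le> 1 + B"
        using N(2) B[of ?a] abs_inner_config_le_1[OF U, of i j] by (auto simp: abs_le_iff)
      have "0 \<le> ?\<phi> * (1 - ?b)"
        using b1 by simp
      moreover have "?b \<le> ?b * N"
        using mult_left_mono[of 1 N ?b] N(1) by simp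
      ultimately have "1 \<le> ?b * N + (\<bar>?a\<bar> + ?c + ?\<phi> * (1 - ?b))"
        using False S by linarith
      then have "1 / N \<le> (?b * N + (\<bar>?a\<bar> + ?c + ?\<phi> * (1 - ?b))) / N"
        using N(1) by (intro divide_right_mono) auto
      also have "\<dots> = ?b + (\<bar>?a\<bar> + ?c + ?\<phi> * (1 - ?b)) / N"
        using N(1) by (simp add: add_divide_distrib)
      finally have "1 / N \<le> ?b + (\<bar>?a\<bar> + ?c + ?\<phi> * (1 - ?b)) / N" .
      moreover have "1 / (1 + B) \<le> 1 / N"
        using N(1) NB by (intro divide_left_mono) auto
      ultimately show ?thesis
        by (intro min.coboundedI2) linarith
    qed
    with S' show ?thesis
      by (simp add: p)
  qed
qed

text \<open>If every opinion had an orthogonal partner, then among three opinions two different such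
  pairs would share a member, and that member would be orthogonal to both others.\<close>

lemma linked_if_not_separable:
  fixes U :: "real^'d^3"
  assumes "is_config U" "\<not> separable U"
  shows "linked U"
proof (rule ccontr)
  assume "\<not> linked U"
  then have ex: "\<exists>j. U $ i \<bullet> U $ j = 0" for i
    by (simp add: linked_def)
  have ne: "j \<noteq> i" if "U $ i \<bullet> U $ j = 0" for i j
    using that inner_config_self[OF assms(1), of i] by auto
  have sep: False if "U $ i \<bullet> U $ j = 0" "U $ i \<bullet> U $ k = 0" "j \<noteq> k" for i j k
  proof -
    have "{i} \<union> {j, k} = UNIV"
      using exhaust_3_distinct[of i j k] ne[OF that(1)] ne[OF that(2)] that(3) by auto
    have "separable U"
      unfolding separable_def
    proof (intro exI conjI)
      show "{i} \<union> {j, k} = UNIV" by fact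
      show "\<forall>a\<in>{i}. \<forall>b\<in>{j, k}. U $ a \<bullet> U $ b = 0" using that by simp
      show "{i} \<inter> {j, k} = {}" using ne[OF that(1)] ne[OF that(2)] by simp
    qed simp_all
    then show False
      using assms(2) by simp
  qed
  obtain j where j: "U $ 1 \<bullet> U $ j = 0"
    using ex by blast
  obtain k where k: "k \<noteq> 1" "k \<noteq> j"
    by (rule ex_third)
  obtain l where l: "U $ k \<bullet> U $ l = 0"
    using ex by blast
  have "l = 1 \<or> l = j"
    using exhaust_3_distinct[of 1 j k l] ne[OF j] ne[OF l] k by auto
  then show False
    using sep[of 1 j k] sep[of j 1 k] j l k ne[OF j] by (auto simp: inner_commute)
qed

text \<open>The opinion orthogonal to none may change. If \<open>u_j\<close> and \<open>u_k\<close>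
  are orthogonal, it must be \<open>i\<close>, whose product with \<open>k\<close> is merely divided
  by \<open>N\<close>. Otherwise \<open>j\<close> takes the role: its product with \<open>k\<close>
  is untouched and that with \<open>i\<close> keeps its sign. Orthogonal pairs do not move, as
  \<open>f 0 = 0\<close>.\<close>

lemma linked_update:
  fixes U :: "real^'d^3"
  assumes f: "stable_update f" and U: "is_config U" and "linked U"
  shows "linked (update f U p)"
proof -
  obtain i j where p: "p = (i, j)" by (cases p)
  let ?U = "update f U (i, j)" and ?a = "U $ i \<bullet> U $ j"
  have self: "V $ l \<bullet> V $ l \<noteq> 0" if "is_config V" for V :: "real^'d^3" and l
    using inner_config_self[OF that] by simp
  have U': "is_config ?U"
    by (rule is_config_update[OF f U])
  show ?thesis
  proof (cases "i = j \<or> ?a = 0")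
    case True
    moreover have "?U = U" if "?a = 0"
    proof -
      have "f ?a = 0"
        using sgn_stable_update[OF f U, of i j] that by (simp add: sgn_zero_iff)
      then show ?thesis
        using U by (simp add: update_def Let_def vec_eq_iff is_config_def)
    qed
    ultimately have "?U = U"
      using update_diag[OF f U] by auto
    then show ?thesis
      using assms(3) p by simp
  next
    case False
    obtain k where k: "k \<noteq> i" "k \<noteq> j" by (rule ex_third)
    have all: "l = i \<or> l = j \<or> l = k" for l
      using exhaust_3_distinct[of i j k l] False k by auto
    have other: "?U $ j = U $ j" "?U $ k = U $ k"
      using False k by (auto simp: update_nth_other)
    have "sgn (?U $ i \<bullet> U $ j) = sgn ?a"
      using False by (intro update_inner_self[OF f U]) auto
    then have ij: "?U $ i \<bullet> ?U $ j \<noteq> 0"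
      using False by (metis other(1) sgn_0_0)
    show ?thesis
    proof (cases "U $ j \<bullet> U $ k = 0")
      case True
      obtain N where N: "1 \<le> N" "?U $ i = (U $ i + f ?a *\<^sub>R U $ j) /\<^sub>R N"
        using update_nth_self[OF f U] by metis
      obtain c where c: "\<And>l. U $ c \<bullet> U $ l \<noteq> 0"
        using assms(3) by (auto simp: linked_def)
      then have "c = i"
        using True all[of c] c[of j] c[of k] by (auto simp: inner_commute)
      then have "?U $ i \<bullet> ?U $ k \<noteq> 0"
        using N(1) c[of k] True by (simp add: other N(2) inner_add)
      then have "?U $ i \<bullet> ?U $ l \<noteq> 0" for l
        using all[of l] ij self[OF U', of i] by auto
      then show ?thesis
        by (auto simp: p linked_def)
    next
      case False
      then have "?U $ j \<bullet> ?U $ k \<noteq> 0"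
        by (simp add: other)
      then have "?U $ j \<bullet> ?U $ l \<noteq> 0" for l
        using all[of l] ij self[OF U', of j] by (auto simp: inner_commute)
      then show ?thesis
        by (auto simp: p linked_def)
    qed
  qed
qed

text \<open>Once \<open>K * \<phi>\<close> is at least 1, the coefficient \<open>y\<close> is at
  least \<open>x\<close>. If opinion \<open>i\<close> is the one less aligned with \<open>k\<close>,
  the part along \<open>u_j\<close> then decides the sign of its new product with \<open>k\<close>,
  and the three signs multiply to a nonnegative number.\<close>

lemma exists_attracting_word:
  fixes U :: "real^'d^3"
  assumes f: "stable_update f" and U: "is_config U"
    and \<phi>: "\<And>z. z \<in> {-1..1} \<Longrightarrow> \<delta> \<le> \<bar>z\<bar> \<Longrightarrow> \<phi> \<le> \<bar>f z\<bar>"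
    and "0 < \<phi>" "0 < \<delta>" "3 * \<delta> \<le> overlap U" "1 \<le> real K * \<phi>"
  shows "\<exists>i j. i \<noteq> j \<and> 0 \<le> triple (foldl (update f) U (replicate K (i, j)))"
proof -
  have "\<exists>i j. i \<noteq> j \<and> \<delta> \<le> \<bar>U $ i \<bullet> U $ j\<bar>"
  proof (rule ccontr)
    assume "\<not> ?thesis"
    then have "\<bar>U $ i \<bullet> U $ j\<bar> < \<delta>" if "i \<noteq> j" for i j
      using that by (metis not_le)
    from this[of 1 2] this[of 2 3] this[of 1 3] assms(6) show False
      by (simp add: overlap_def)
  qed
  then obtain i j where ij: "i \<noteq> j" "\<delta> \<le> \<bar>U $ i \<bullet> U $ j\<bar>"
    by blast
  obtain k where k: "k \<noteq> i" "k \<noteq> j"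
    by (rule ex_third)
  \<comment> \<open>Stated for both orders of the pair, since the opinion with the smaller absolute
    product with \<open>k\<close> is the one that should move.\<close>
  have *: "0 \<le> triple (foldl (update f) U (replicate K (i, j)))"
    if ij: "i \<noteq> j" "k \<noteq> i" "k \<noteq> j" "\<delta> \<le> \<bar>U $ i \<bullet> U $ j\<bar>"
      and le: "\<bar>U $ i \<bullet> U $ k\<bar> \<le> \<bar>U $ j \<bullet> U $ k\<bar>" for i j
  proof -
    let ?V = "foldl (update f) U (replicate K (i, j))" and ?\<sigma> = "sgn (U $ i \<bullet> U $ j)"
    obtain x y where V: "\<And>l. l \<noteq> i \<Longrightarrow> ?V $ l = U $ l" "sgn (?V $ i \<bullet> U $ j) = ?\<sigma>"
      and xy: "0 < x" "x \<le> 1" "real K * \<phi> * x \<le> y"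
      and Vi: "?V $ i = x *\<^sub>R U $ i + (y * ?\<sigma>) *\<^sub>R U $ j"
      using foldl_update_replicate[OF f U ij(1) \<phi> assms(5) ij(4), where k = K] assms(4) by auto
    let ?c = "U $ i \<bullet> U $ k" and ?b = "U $ j \<bullet> U $ k"
    have "U $ i \<bullet> U $ j \<noteq> 0"
      using ij(4) assms(5) by auto
    then have "?\<sigma> * ?\<sigma> = 1"
      by (simp add: sgn_if)
    have "1 * x \<le> real K * \<phi> * x"
      using assms(7) xy(1) by (intro mult_right_mono) auto
    then have "x \<le> y"
      using xy(3) by simp
    have "\<bar>?\<sigma> * x * ?c * ?b\<bar> = x * (\<bar>?c\<bar> * \<bar>?b\<bar>)"
      using xy(1) \<open>U $ i \<bullet> U $ j \<noteq> 0\<close> by (simp add: abs_mult abs_sgn_eq)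
    also have "\<dots> \<le> y * (\<bar>?b\<bar> * \<bar>?b\<bar>)"
      using xy(1) \<open>x \<le> y\<close> le by (intro mult_mono) auto
    also have "\<dots> = y * ?b * ?b"
      by simp
    \<comment> \<open>This is \<open>?\<sigma> * ?b\<close> times the new product with
      \<open>k\<close>, after using \<open>?\<sigma> * ?\<sigma> = 1\<close>.\<close>
    finally have nonneg: "0 \<le> ?\<sigma> * x * ?c * ?b + y * ?b * ?b"
      by linarith
    have "triple ?V = (?V $ i \<bullet> U $ j) * ?b * (x * ?c + y * ?\<sigma> * ?b)"
      using ij triple_eq[of i j k ?V] by (simp add: V(1) Vi[THEN arg_cong[where f = "\<lambda>v. v \<bullet> U $ k"]] inner_add)
    also have "?V $ i \<bullet> U $ j = \<bar>?V $ i \<bullet> U $ j\<bar> * ?\<sigma>"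
      unfolding V(2)[symmetric] by (simp add: abs_mult_sgn)
    also have "\<bar>?V $ i \<bullet> U $ j\<bar> * ?\<sigma> * ?b * (x * ?c + y * ?\<sigma> * ?b)
        = \<bar>?V $ i \<bullet> U $ j\<bar> * (?\<sigma> * x * ?c * ?b + (?\<sigma> * ?\<sigma>) * (y * ?b * ?b))"
      by (simp only: algebra_simps)
    also have "\<dots> \<ge> 0"
      using nonneg by (simp add: \<open>?\<sigma> * ?\<sigma> = 1\<close>)
    finally show ?thesis .
  qed
  show ?thesis
  proof (cases "\<bar>U $ i \<bullet> U $ k\<bar> \<le> \<bar>U $ j \<bullet> U $ k\<bar>")
    case True
    then show ?thesis
      using *[of i j] ij k by blast
  next
    case False
    then show ?thesis
      using *[of j i] ij k by (intro exI[of _ j] exI[of _ i]) (auto simp: inner_commute)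
  qed
qed

text \<open>Signs are taken relative to an opinion \<open>i\<close> orthogonal to none, which
  settles all pairs containing \<open>i\<close>. For the remaining pair, the triple product is a
  positive factor times the signed inner product.\<close>

lemma exists_same_side:
  fixes U :: "real^'d^3"
  assumes "is_config U" "linked U" "0 \<le> triple U"
  obtains s where "\<And>i. \<bar>s i\<bar> = 1" "same_side s U"
proof -
  obtain i where i: "\<And>j. U $ i \<bullet> U $ j \<noteq> 0"
    using assms(2) by (auto simp: linked_def)
  define s where "s l = sgn (U $ i \<bullet> U $ l)" for l
  have s: "\<bar>s l\<bar> = 1" "s l * s l = 1" for l
    using i[of l] by (auto simp: s_def sgn_if)
  have "s i = 1"
    using inner_config_self[OF assms(1), of i] by (simp add: s_def)
  have star: "0 \<le> s i * s l * (U $ i \<bullet> U $ l)" for l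
    using i[of l] \<open>s i = 1\<close> by (auto simp: s_def sgn_if)
  have "0 \<le> s p * s q * (U $ p \<bullet> U $ q)" for p q
  proof -
    consider "p = q" | "p = i" | "q = i" | "p \<noteq> q" "p \<noteq> i" "q \<noteq> i" by blast
    then show ?thesis
    proof cases
      case 1
      then show ?thesis using s(2)[of q] by simp
    next
      case 2
      then show ?thesis using star by simp
    next
      case 3
      then show ?thesis using star[of p] by (simp add: inner_commute mult_ac)
    next
      case 4
      have "triple U = (U $ i \<bullet> U $ p) * (U $ p \<bullet> U $ q) * (U $ i \<bullet> U $ q)"
        using 4 by (intro triple_eq) auto
      also have "\<dots> = \<bar>U $ i \<bullet> U $ p\<bar> * s p * (U $ p \<bullet> U $ q) * (\<bar>U $ i \<bullet> U $ q\<bar> * s q)"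
        by (simp add: s_def abs_mult_sgn)
      also have "\<dots> = \<bar>U $ i \<bullet> U $ p\<bar> * \<bar>U $ i \<bullet> U $ q\<bar> * (s p * s q * (U $ p \<bullet> U $ q))"
        by (simp only: mult_ac)
      finally have "0 \<le> \<bar>U $ i \<bullet> U $ p\<bar> * \<bar>U $ i \<bullet> U $ q\<bar> * (s p * s q * (U $ p \<bullet> U $ q))"
        using assms(3) by simp
      moreover have "0 < \<bar>U $ i \<bullet> U $ p\<bar> * \<bar>U $ i \<bullet> U $ q\<bar>"
        using i by simp
      ultimately show ?thesis
        by (simp only: zero_le_mult_iff) linarith
    qed
  qed
  then have "same_side s U"
    by (simp add: same_side_def mult.assoc mult.left_commute)
  then show thesis
    using that s(1) by blast
qed

section \<open>Leaving partially orthogonal configurations in one step\<close>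

lemma nonorthogonal_3:
  fixes V :: "real^'d^3"
  assumes "i \<noteq> j" "j \<noteq> k" "i \<noteq> k" "\<And>l. V $ l \<bullet> V $ l \<noteq> 0"
    and "V $ i \<bullet> V $ j \<noteq> 0" "V $ j \<bullet> V $ k \<noteq> 0" "V $ i \<bullet> V $ k \<noteq> 0"
  shows "V $ l \<bullet> V $ m \<noteq> 0"
  using exhaust_3_distinct[OF assms(1-3), of l] exhaust_3_distinct[OF assms(1-3), of m] assms(4-)
  by (elim disjE) (simp_all add: inner_commute)

text \<open>With \<open>i\<close> orthogonal to none, at most one pair \<open>j\<close>,
  \<open>k\<close> is orthogonal. Letting \<open>j\<close> interact with \<open>i\<close> adds a
  nonzero multiple of \<open>u_i\<close> to \<open>u_j\<close>, so its product with
  \<open>u_k\<close> becomes nonzero. This prepares a strictly positive lower bound for all flipped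
  products.\<close>

lemma exists_nonorthogonal_update:
  fixes U :: "real^'d^3"
  assumes f: "stable_update f" and U: "is_config U" and "linked U"
  shows "\<exists>i j. i \<noteq> j \<and> ((\<forall>k l. U $ k \<bullet> U $ l \<noteq> 0) \<or>
    (\<forall>k l. update f U (i, j) $ k \<bullet> update f U (i, j) $ l \<noteq> 0))"
proof (cases "\<forall>k l. U $ k \<bullet> U $ l \<noteq> 0")
  case True
  then show ?thesis
    by (intro exI[of _ 1] exI[of _ 2]) auto
next
  case False
  then obtain j k where jk: "U $ j \<bullet> U $ k = 0"
    by blast
  obtain i where i: "\<And>l. U $ i \<bullet> U $ l \<noteq> 0"
    using assms(3) by (auto simp: linked_def)
  have ne: "j \<noteq> k" "i \<noteq> j" "i \<noteq> k"
    using jk i[of j] i[of k] inner_config_self[OF U, of j] by (auto simp: inner_commute)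
  let ?U = "update f U (j, i)" and ?a = "U $ j \<bullet> U $ i"
  obtain N where N: "1 \<le> N" "?U $ j = (U $ j + f ?a *\<^sub>R U $ i) /\<^sub>R N"
    using update_nth_self[OF f U] by metis
  have other: "?U $ i = U $ i" "?U $ k = U $ k"
    using ne by (auto simp: update_nth_other)
  have "?a \<noteq> 0"
    using i[of j] by (simp add: inner_commute)
  moreover have "sgn (?U $ j \<bullet> U $ i) = sgn ?a"
    using ne by (intro update_inner_self[OF f U]) auto
  ultimately have "?U $ j \<bullet> ?U $ i \<noteq> 0"
    by (metis other(1) sgn_0_0)
  moreover have "f ?a \<noteq> 0"
    using \<open>?a \<noteq> 0\<close> sgn_stable_update[OF f U, of j i] by (metis sgn_0_0)
  then have "?U $ j \<bullet> ?U $ k \<noteq> 0"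
    using N(1) i[of k] jk by (simp add: other N(2) inner_add)
  moreover have "?U $ i \<bullet> ?U $ k \<noteq> 0"
    using i by (simp add: other)
  moreover have "?U $ l \<bullet> ?U $ l \<noteq> 0" for l
    using inner_config_self[OF is_config_update[OF f U]] by simp
  ultimately have "?U $ l \<bullet> ?U $ m \<noteq> 0" for l m
    using nonorthogonal_3[of i j k ?U l m] ne by (simp add: inner_commute)
  then show ?thesis
    using ne by (intro exI[of _ j] exI[of _ i]) blast
qed

section \<open>Clustering and polarization\<close>

lemma same_side_foldl_update_inner_ge:
  assumes f: "stable_update f" and U: "is_config U" and s: "\<And>i. \<bar>s i\<bar> = 1"
    and m: "0 \<le> m" "\<And>i j. m \<le> (s i *\<^sub>R U $ i) \<bullet> (s j *\<^sub>R U $ j)"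
  shows "m \<le> (s k *\<^sub>R foldl (update f) U w $ k) \<bullet> (s l *\<^sub>R foldl (update f) U w $ l)"
  using U m(2)
proof (induction w arbitrary: U)
  case Nil
  then show ?case by simp
next
  case (Cons p w)
  show ?case
    unfolding foldl_Cons
    by (rule Cons.IH[OF is_config_update[OF f Cons.prems(1)]])
       (rule same_side_update_inner_ge[OF f Cons.prems(1) s m(1) Cons.prems(2)])
qed

text \<open>Opinion \<open>i\<close> ends as \<open>x * u_i + y * sgn a * u_j\<close>. Unit length
  forces \<open>x + y\<close> to be at least 1, and \<open>y\<close> is at least
  \<open>R * x\<close>, so \<open>y\<close> is at least \<open>R / (R + 1)\<close>. After flipping,
  the \<open>u_i\<close> part contributes nonnegatively, so the product is at least
  \<open>y\<close>.\<close>

lemma foldl_update_replicate_inner_ge: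
  fixes U :: "real^'d^'n"
  assumes f: "stable_update f" and U: "is_config U" and "i \<noteq> j"
    and \<phi>: "\<And>z. z \<in> {-1..1} \<Longrightarrow> m \<le> \<bar>z\<bar> \<Longrightarrow> \<phi> \<le> \<bar>f z\<bar>" "0 \<le> \<phi>"
    and s: "\<And>i. \<bar>s i\<bar> = 1"
    and m: "0 < m" "m \<le> (s i *\<^sub>R U $ i) \<bullet> (s j *\<^sub>R U $ j)"
    and R: "0 \<le> R" "R \<le> real K * \<phi>"
  shows "R / (R + 1) \<le> (s i *\<^sub>R foldl (update f) U (replicate K (i, j)) $ i) \<bullet> (s j *\<^sub>R U $ j)"
proof -
  let ?V = "foldl (update f) U (replicate K (i, j))"
  let ?a = "U $ i \<bullet> U $ j"
  have ss: "s i * s i = 1" "s j * s j = 1"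
    using s by (metis abs_mult_self_eq mult_1)+
  have m': "m \<le> s i * s j * ?a"
    using m(2) by (simp add: mult_ac)
  have "m \<le> \<bar>s i * s j * ?a\<bar>"
    using m' by linarith
  then have "m \<le> \<bar>?a\<bar>"
    by (simp add: abs_mult s)
  then obtain x y where xy: "0 < x" "x \<le> 1" "real K * \<phi> * x \<le> y"
    and V: "?V $ i = x *\<^sub>R U $ i + (y * sgn ?a) *\<^sub>R U $ j"
    using foldl_update_replicate[OF f U \<open>i \<noteq> j\<close> \<phi>(1) m(1) _ \<phi>(2), where k = K] by auto
  have "sgn (s k) = s k" for k
    using sgn_mult_abs[of "s k"] s by simp
  moreover have "sgn (s i * s j * ?a) = 1"
    using m' m(1) by simp
  ultimately have sgn_eq: "s i * s j * sgn ?a = 1"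
    by (simp add: sgn_mult)
  have "0 \<le> real K * \<phi> * x"
    using xy(1) \<phi>(2) by simp
  then have "0 \<le> y"
    using xy(3) by linarith
  have "norm (?V $ i) = 1" "norm (U $ i) = 1" "norm (U $ j) = 1"
    using is_config_foldl_update[OF f U, of "replicate K (i, j)"] U by (simp_all add: is_config_def)
  moreover have "norm (?V $ i) \<le> norm (x *\<^sub>R U $ i) + norm ((y * sgn ?a) *\<^sub>R U $ j)"
    unfolding V by (rule norm_triangle_ineq)
  moreover have "\<bar>sgn ?a\<bar> \<le> 1"
    by (simp add: abs_sgn_eq)
  then have "\<bar>y * sgn ?a\<bar> \<le> y"
    using \<open>0 \<le> y\<close> mult_left_mono[of "\<bar>sgn ?a\<bar>" 1 y] by (simp add: abs_mult)
  ultimately have "1 \<le> x + y"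
    using xy(1) by simp
  have "R * x \<le> y"
    using xy(3) mult_right_mono[OF R(2), of x] xy(1) by linarith
  moreover have "R * 1 \<le> R * (x + y)"
    using R(1) \<open>1 \<le> x + y\<close> by (intro mult_left_mono) auto
  ultimately have "R \<le> y * (R + 1)"
    by (simp add: algebra_simps)
  then have "R / (R + 1) \<le> y"
    using R(1) by (subst pos_divide_le_eq) auto
  also have "y \<le> x * (s i * s j * ?a) + y * (s i * s j * sgn ?a)"
    unfolding sgn_eq using xy(1) m' m(1) by simp
  also have "\<dots> = (s i *\<^sub>R ?V $ i) \<bullet> (s j *\<^sub>R U $ j)"
    unfolding V using inner_config_self[OF U, of j] by (simp add: inner_add algebra_simps)
  finally show ?thesis .
qed

text \<open>The first block pulls opinion 1 to opinion 3, the second pulls opinion 2 there; opinion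
  3 never moves and opinion 1 rests during the second block.\<close>

lemma foldl_update_cluster:
  fixes U :: "real^'d^3"
  assumes f: "stable_update f" and U: "is_config U"
    and \<phi>: "\<And>z. z \<in> {-1..1} \<Longrightarrow> m \<le> \<bar>z\<bar> \<Longrightarrow> \<phi> \<le> \<bar>f z\<bar>" "0 \<le> \<phi>"
    and s: "\<And>i. \<bar>s i\<bar> = 1"
    and m: "0 < m" "\<And>i j. m \<le> (s i *\<^sub>R U $ i) \<bullet> (s j *\<^sub>R U $ j)"
    and R: "0 \<le> R" "R \<le> real K * \<phi>"
  shows "R / (R + 1) \<le>
    (s l *\<^sub>R foldl (update f) U (replicate K (1, 3) @ replicate K (2, 3)) $ l) \<bullet> (s 3 *\<^sub>R U $ 3)"
proof -
  define V where "V = foldl (update f) U (replicate K (1, 3))"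
  define W where "W = foldl (update f) V (replicate K (2, 3))"
  have V: "is_config V"
    unfolding V_def by (rule is_config_foldl_update[OF f U])
  have fixed: "foldl (update f) U (replicate K (i, j)) $ k = U $ k" if "k \<noteq> i"
    for U :: "real^'d^3" and i j k
    using that by (induction K arbitrary: U) (simp_all add: update_nth_other)
  have W_nth: "W $ 1 = V $ 1" "W $ 3 = U $ 3" "V $ 3 = U $ 3"
    by (simp_all add: W_def V_def fixed)
  \<comment> \<open>Flipped products never fall below their minimum, so \<open>m\<close>, and with
    it \<open>\<phi>\<close> and \<open>K\<close>, still serves the second block.\<close>
  have mV: "m \<le> (s i *\<^sub>R V $ i) \<bullet> (s j *\<^sub>R V $ j)" for i j
    unfolding V_def using m by (intro same_side_foldl_update_inner_ge[OF f U s]) auto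
  have "R / (R + 1) \<le> (s 1 *\<^sub>R V $ 1) \<bullet> (s 3 *\<^sub>R U $ 3)"
    unfolding V_def by (rule foldl_update_replicate_inner_ge[OF f U _ \<phi> s m R]) simp
  moreover have "R / (R + 1) \<le> (s 2 *\<^sub>R W $ 2) \<bullet> (s 3 *\<^sub>R V $ 3)"
    unfolding W_def by (rule foldl_update_replicate_inner_ge[OF f V _ \<phi> s m(1) mV R]) simp
  moreover have "R / (R + 1) \<le> (s 3 *\<^sub>R U $ 3) \<bullet> (s 3 *\<^sub>R U $ 3)"
  proof -
    have "(s 3 *\<^sub>R U $ 3) \<bullet> (s 3 *\<^sub>R U $ 3) = \<bar>s 3\<bar> * \<bar>s 3\<bar> * (U $ 3 \<bullet> U $ 3)"
      by (simp only: inner_scaleR_left inner_scaleR_right abs_mult_self_eq mult.assoc)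
    then show ?thesis
      using R(1) s inner_config_self[OF U, of 3] by simp
  qed
  moreover have "foldl (update f) U (replicate K (1, 3) @ replicate K (2, 3)) = W"
    by (simp add: W_def V_def)
  ultimately show ?thesis
    using exhaust_3[of l] W_nth by auto
qed

text \<open>For unit vectors the squared distance is \<open>2 - 2 * (v \<bullet> y)\<close>, so caps
  of threshold \<open>n / (n + 1)\<close> become arbitrarily small, even though their centres may
  vary with \<open>n\<close>. The flipped opinions are therefore jointly Cauchy with one common
  limit, and undoing the signs gives a polarized limit.\<close>

lemma polarizes_if_clustering:
  fixes X :: "nat \<Rightarrow> real^'d^'n"
  assumes X: "\<And>t. is_config (X t)" and s: "\<And>i. \<bar>s i\<bar> = 1"
    and cluster: "\<And>n. \<exists>T y. norm y = 1 \<and>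
      (\<forall>t\<ge>T. \<forall>l. real n / (real n + 1) \<le> (s l *\<^sub>R X t $ l) \<bullet> y)"
  shows "polarizes X"
proof -
  define V where "V t l = s l *\<^sub>R X t $ l" for t l
  have ss: "s i * s i = 1" for i
    using s by (metis abs_mult_self_eq mult_1)
  have close: "\<exists>T. \<forall>t\<ge>T. \<forall>t'\<ge>T. \<forall>l l'. dist (V t l) (V t' l') < e" if "e > 0" for e
  proof -
    \<comment> \<open>Chosen so that \<open>2 / (n + 1)\<close> is below
      \<open>(e / 2)\<^sup>2\<close>, which puts every flipped opinion within \<open>e / 2\<close>
      of the cap centre.\<close>
    have "0 < (e / 2)\<^sup>2 / 2"
      using that by simp
    then obtain n where n: "inverse (real (Suc n)) < (e / 2)\<^sup>2 / 2"
      using reals_Archimedean by blast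
    obtain T y where y: "norm y = 1"
      and T: "\<And>t l. t \<ge> T \<Longrightarrow> real n / (real n + 1) \<le> V t l \<bullet> y"
      using cluster[of n] unfolding V_def by blast
    have near: "dist (V t l) y < e / 2" if "t \<ge> T" for t l
    proof (rule power2_less_imp_less)
      have "norm (V t l) = \<bar>s l\<bar> * norm (X t $ l)"
        by (simp add: V_def)
      then have "norm (V t l) = 1"
        using X[of t] s by (simp add: is_config_def)
      then have "V t l \<bullet> V t l = 1" "y \<bullet> y = 1"
        using y by (simp_all add: norm_eq_1)
      then have "(dist (V t l) y)\<^sup>2 = 2 - 2 * (V t l \<bullet> y)"
        unfolding dist_norm power2_norm_eq_inner inner_diff_left inner_diff_right inner_commute[of y "V t l"]
        by simp
      also have "\<dots> \<le> 2 - 2 * (real n / (real n + 1))"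
        using T[OF that, of l] by simp
      also have "\<dots> = 2 * inverse (real (Suc n))"
        by (simp add: field_simps)
      also have "\<dots> < (e / 2)\<^sup>2"
        using n by simp
      finally show "(dist (V t l) y)\<^sup>2 < (e / 2)\<^sup>2" .
    qed (use \<open>e > 0\<close> in simp)
    have "dist (V t l) (V t' l') < e" if "t \<ge> T" "t' \<ge> T" for t t' l l'
      by (rule dist_triangle_half_l[OF near[OF that(1)] near[OF that(2)]])
    then show ?thesis
      by blast
  qed
  \<comment> \<open>One arbitrary opinion supplies the limit; closeness across indices passes it on
    to the others.\<close>
  fix l0 :: 'n
  have "Cauchy (\<lambda>t. V t l0)"
    unfolding Cauchy_def using close by blast
  then obtain L where L: "(\<lambda>t. V t l0) \<longlonglongrightarrow> L"
    using Cauchy_convergent convergent_def by blast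
  have VL: "(\<lambda>t. V t l) \<longlonglongrightarrow> L" for l
  proof -
    have "(\<lambda>t. V t l - V t l0) \<longlonglongrightarrow> 0"
    proof (rule LIMSEQ_I)
      fix r :: real assume "0 < r"
      from close[OF this] show "\<exists>T. \<forall>t\<ge>T. norm (V t l - V t l0 - 0) < r"
        unfolding diff_zero dist_norm by blast
    qed
    from tendsto_add[OF this L] show ?thesis
      by simp
  qed
  have "(\<lambda>t. s l *\<^sub>R V t l) \<longlonglongrightarrow> s l *\<^sub>R L" for l
    by (intro tendsto_intros VL)
  then have XL: "(\<lambda>t. X t $ l) \<longlonglongrightarrow> s l *\<^sub>R L" for l
    using ss by (simp add: V_def)
  have "X \<longlonglongrightarrow> (\<chi> l. s l *\<^sub>R L)"
    by (rule vec_tendstoI) (simp only: vec_lambda_beta XL)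
  moreover have "polarized (\<chi> l. s l *\<^sub>R L)"
    unfolding polarized_def
  proof (intro allI)
    fix i j
    have "s i = 1 \<or> s i = -1" "s j = 1 \<or> s j = -1"
      using s[of i] s[of j] by linarith+
    then show "(\<chi> l. s l *\<^sub>R L) $ i = (\<chi> l. s l *\<^sub>R L) $ j \<or> (\<chi> l. s l *\<^sub>R L) $ i = - (\<chi> l. s l *\<^sub>R L) $ j"
      by auto
  qed
  ultimately show ?thesis
    unfolding polarizes_def by blast
qed

section \<open>Trajectories as folds, and invariants along them\<close>

lemma traj_eq_foldl: "traj f U \<omega> t = foldl (update f) U (stake t \<omega>)"
  by (induction t) (simp_all add: stake_Suc del: stake.simps(2))

lemma traj_add: "traj f U \<omega> (t + n) = foldl (update f) (traj f U \<omega> t) (stake n (sdrop t \<omega>))"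
  unfolding traj_eq_foldl stake_add[symmetric] foldl_append ..

lemma is_config_traj:
  assumes "stable_update f" "is_config U"
  shows "is_config (traj f U \<omega> t)"
  unfolding traj_eq_foldl by (rule is_config_foldl_update[OF assms])

lemma linked_traj:
  fixes U :: "real^'d^3"
  assumes "stable_update f" "is_config U" "linked U"
  shows "linked (traj f U \<omega> t)"
  by (induction t) (simp_all add: assms linked_update is_config_traj)

text \<open>The bound is chosen before \<open>\<omega>\<close>, so that the word length derived from
  it is a constant, as the word-occurrence lemma requires.\<close>

lemma overlap_traj_bounded_below:
  fixes U :: "real^'d^3"
  assumes f: "stable_update f" and U: "is_config U" and "linked U"
  obtains \<sigma> where "0 < \<sigma>" "\<And>\<omega> t. \<sigma> \<le> overlap (traj f U \<omega> t)"
proof -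
  obtain B where B: "0 \<le> B" "\<And>z. z \<in> {-1..1} \<Longrightarrow> \<bar>f z\<bar> \<le> B"
    using stable_update_bounded_above[OF f] by blast
  have "0 < overlap U"
  proof -
    obtain i where i: "\<And>j. U $ i \<bullet> U $ j \<noteq> 0"
      using assms(3) by (auto simp: linked_def)
    obtain j where j: "j \<noteq> i" "j \<noteq> i" by (rule ex_third)
    obtain k where k: "k \<noteq> i" "k \<noteq> j" by (rule ex_third)
    show ?thesis
      using overlap_eq[of i j k U] i[of j] j k by simp
  qed
  moreover have "min (overlap U) (1 / (1 + B)) \<le> overlap (traj f U \<omega> t)" for \<omega> t
  proof (induction t)
    case (Suc t)
    then show ?case
      using overlap_update_ge[OF f is_config_traj[OF f U] B(2), of \<omega> t "\<omega> !! t"] by simp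
  qed simp
  ultimately show thesis
    using B(1) by (intro that[of "min (overlap U) (1 / (1 + B))"]) auto
qed

text \<open>The deterministic part. The signs are fixed at \<open>t0\<close>. At a later time with
  no orthogonal pair, all flipped products are at least some \<open>m > 0\<close>, and this
  persists. For each \<open>n\<close>, a later word with \<open>K * \<phi>\<close> at least
  \<open>n\<close> puts all flipped opinions in a cap of threshold \<open>n / (n + 1)\<close>, where
  they stay. Since \<open>K\<close> depends on \<open>\<omega>\<close> through \<open>m\<close>,
  words are assumed for every \<open>K\<close>.\<close>

lemma polarizes_if_words_occur:
  fixes U0 :: "real^'d^3"
  assumes f: "stable_update f" and U0: "is_config U0" and "linked U0"
    and triple: "0 \<le> triple (traj f U0 \<omega> t0)"
    and nonorth: "\<exists>t\<ge>t0. \<forall>k l. traj f U0 \<omega> t $ k \<bullet> traj f U0 \<omega> t $ l \<noteq> 0"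
    and words: "\<And>K T. \<exists>t\<ge>T. stake (K + K) (sdrop t \<omega>) = replicate K (1, 3) @ replicate K (2, 3)"
  shows "polarizes (traj f U0 \<omega>)"
proof -
  let ?X = "traj f U0 \<omega>"
  note cX = is_config_traj[OF f U0]
  obtain s where s: "\<And>i. \<bar>s i\<bar> = 1" "same_side s (?X t0)"
    using exists_same_side[OF cX linked_traj[OF f U0 assms(3)] triple] by metis
  obtain t1 where t1: "t1 \<ge> t0" "\<And>k l. ?X t1 $ k \<bullet> ?X t1 $ l \<noteq> 0"
    using nonorth by blast
  have mono: "m \<le> (s k *\<^sub>R ?X t $ k) \<bullet> (s l *\<^sub>R ?X t $ l)"
    if m: "0 \<le> m" "\<And>i j. m \<le> (s i *\<^sub>R ?X t' $ i) \<bullet> (s j *\<^sub>R ?X t' $ j)" and "t' \<le> t" for m t t' k l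
  proof -
    obtain n where "t = t' + n"
      using \<open>t' \<le> t\<close> le_Suc_ex by blast
    then show ?thesis
      using same_side_foldl_update_inner_ge[OF f cX s(1) m] by (simp only: traj_add)
  qed
  have side: "same_side s (?X t)" if "t \<ge> t0" for t
    unfolding same_side_def using mono[of 0 t0 t] s(2) that by (auto simp only: same_side_def)
  define m where "m = Min (range (\<lambda>(k, l). (s k *\<^sub>R ?X t1 $ k) \<bullet> (s l *\<^sub>R ?X t1 $ l)))"
  have "0 < (s k *\<^sub>R ?X t1 $ k) \<bullet> (s l *\<^sub>R ?X t1 $ l)" for k l
  proof -
    have "s k \<noteq> 0" "s l \<noteq> 0"
      using s(1) by (metis abs_zero zero_neq_one)+
    then have "(s k *\<^sub>R ?X t1 $ k) \<bullet> (s l *\<^sub>R ?X t1 $ l) \<noteq> 0"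
      using t1(2) by simp
    then show ?thesis
      using side[OF t1(1)] unfolding same_side_def by (metis order_le_less)
  qed
  then have m: "0 < m"
    unfolding m_def by (subst Min_gr_iff) auto
  have m_le: "m \<le> (s k *\<^sub>R ?X t1 $ k) \<bullet> (s l *\<^sub>R ?X t1 $ l)" for k l
    unfolding m_def by (rule Min_le) (auto intro: rev_image_eqI[of "(k, l)"])
  obtain \<phi> where \<phi>: "0 < \<phi>" "\<And>z. z \<in> {-1..1} \<Longrightarrow> m \<le> \<bar>z\<bar> \<Longrightarrow> \<phi> \<le> \<bar>f z\<bar>"
    using stable_update_bounded_below[OF f m] by blast
  show ?thesis
  proof (rule polarizes_if_clustering[OF cX s(1)])
    fix n
    obtain K where K: "real n \<le> real K * \<phi>"
      using reals_Archimedean3[OF \<phi>(1)] less_imp_le by blast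
    obtain t where t: "t \<ge> t1" "stake (K + K) (sdrop t \<omega>) = replicate K (1, 3) @ replicate K (2, 3)"
      using words by blast
    let ?y = "s 3 *\<^sub>R ?X t $ 3"
    have m_t: "m \<le> (s k *\<^sub>R ?X t $ k) \<bullet> (s l *\<^sub>R ?X t $ l)" for k l
      using mono[OF _ m_le t(1)] m by simp
    have start: "real n / (real n + 1) \<le> (s l *\<^sub>R ?X (t + (K + K)) $ l) \<bullet> ?y" for l
      unfolding traj_add[of f U0 \<omega> t] t(2)
      using K \<phi> by (intro foldl_update_cluster[OF f cX \<phi>(2) _ s(1) m m_t]) auto
    have "real n / (real n + 1) \<le> (s l *\<^sub>R ?X t' $ l) \<bullet> ?y" if "t' \<ge> t + (K + K)" for t' l
      using that
    proof (induction t' arbitrary: l rule: dec_induct)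
      case base
      show ?case by (rule start)
    next
      case (step t')
      show ?case
        unfolding traj.simps
        by (rule same_side_update_ge[OF f cX s(1) side _ step.IH]) (use step t t1 in auto)
    qed
    moreover have "norm ?y = 1"
      using cX[of \<omega> t] s(1) by (simp add: is_config_def)
    ultimately show "\<exists>T y. norm y = 1 \<and> (\<forall>t\<ge>T. \<forall>l. real n / (real n + 1) \<le> (s l *\<^sub>R ?X t $ l) \<bullet> y)"
      by blast
  qed
qed

theorem mainTheorem3:
  fixes f :: "real \<Rightarrow> real"
    and D :: "(3 \<times> 3) pmf"
    and U0 :: "real^'d^3"
  assumes "CARD('d) \<ge> 2"
    and "stable_update f"
    and "set_pmf D \<subseteq> {(i, j). i \<noteq> j}"
    and "\<forall>i j. i \<noteq> j \<longrightarrow> pmf D (i, j) > 0"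
    and "is_config U0"
    and "\<not> separable U0"
  shows "AE \<omega> in stream_space (measure_pmf D). polarizes (traj f U0 \<omega>)"
proof -
  note f = assms(2) and U0 = assms(5)
  have linked: "linked U0"
    by (rule linked_if_not_separable[OF U0 assms(6)])
  have supp: "(i, j) \<in> set_pmf D" if "i \<noteq> j" for i j
    unfolding set_pmf_iff using assms(4) that by (metis less_irrefl)
  obtain \<sigma> where \<sigma>: "0 < \<sigma>" "\<And>\<omega> t. \<sigma> \<le> overlap (traj f U0 \<omega> t)"
    using overlap_traj_bounded_below[OF f U0 linked] by blast
  \<comment> \<open>One of the three absolute inner products is at least a third of their
    sum.\<close>
  obtain \<phi> where \<phi>: "0 < \<phi>" "\<And>z. z \<in> {-1..1} \<Longrightarrow> \<sigma> / 3 \<le> \<bar>z\<bar> \<Longrightarrow> \<phi> \<le> \<bar>f z\<bar>"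
    using stable_update_bounded_below[OF f, of "\<sigma> / 3"] \<sigma>(1) by auto
  obtain K where K: "1 \<le> real K * \<phi>"
    using reals_Archimedean3[OF \<phi>(1)] less_imp_le by blast
  \<comment> \<open>A suitable word must exist for every state, so the invariants of the trajectory
    become a premise; where they fail, any word of the right length serves.\<close>
  let ?Q1 = "\<lambda>(U :: real^'d^3) w. is_config U \<and> \<sigma> \<le> overlap U \<longrightarrow> 0 \<le> triple (foldl (update f) U w)"
  have "\<exists>w. set w \<subseteq> set_pmf D \<and> length w = K \<and> ?Q1 U w" for U
  proof (cases "is_config U \<and> \<sigma> \<le> overlap U")
    case True
    have "\<exists>i j. i \<noteq> j \<and> 0 \<le> triple (foldl (update f) U (replicate K (i, j)))"
      by (rule exists_attracting_word[where \<delta> = "\<sigma> / 3", OF f _ \<phi>(2) \<phi>(1) _ _ K])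
         (use True \<sigma>(1) in auto)
    then obtain i j where "i \<noteq> j" "0 \<le> triple (foldl (update f) U (replicate K (i, j)))"
      by blast
    then show ?thesis
      using supp by (intro exI[of _ "replicate K (i, j)"]) (auto simp: set_replicate_conv_if)
  next
    case False
    then show ?thesis
      using supp[of 1 2] by (intro exI[of _ "replicate K (1, 2)"]) (auto simp: set_replicate_conv_if)
  qed
  from AE_state_word_frequently[of D K ?Q1 "update f" U0, OF this]
  have Q1: "AE \<omega> in stream_space (measure_pmf D). \<exists>t. 0 \<le> triple (traj f U0 \<omega> t)"
  proof eventually_elim
    case (elim \<omega>)
    then obtain t where "?Q1 (traj f U0 \<omega> t) (stake K (sdrop t \<omega>))"
      unfolding traj_eq_foldl by blast
    then have "0 \<le> triple (traj f U0 \<omega> (t + K))"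
      unfolding traj_add using is_config_traj[OF f U0] \<sigma>(2) by blast
    then show ?case ..
  qed
  let ?nonorth = "\<lambda>U :: real^'d^3. \<forall>k l. U $ k \<bullet> U $ l \<noteq> 0"
  \<comment> \<open>One letter suffices, and the disjunction covers states that need no repair:
    nonorthogonality then holds at time \<open>t\<close> or at \<open>t + 1\<close>.\<close>
  let ?Q2 = "\<lambda>(U :: real^'d^3) w. is_config U \<and> linked U \<longrightarrow> ?nonorth U \<or> ?nonorth (foldl (update f) U w)"
  have "\<exists>w. set w \<subseteq> set_pmf D \<and> length w = 1 \<and> ?Q2 U w" for U
  proof (cases "is_config U \<and> linked U")
    case True
    then obtain i j where "i \<noteq> j" "?nonorth U \<or> ?nonorth (update f U (i, j))"
      using exists_nonorthogonal_update[OF f, of U] by blast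
    then show ?thesis
      using supp by (intro exI[of _ "[(i, j)]"]) auto
  next
    case False
    then show ?thesis
      using supp[of 1 2] by (intro exI[of _ "[(1, 2)]"]) auto
  qed
  from AE_state_word_frequently[of D 1 ?Q2 "update f" U0, OF this]
  have Q2: "AE \<omega> in stream_space (measure_pmf D). \<forall>T. \<exists>t\<ge>T. ?nonorth (traj f U0 \<omega> t)"
  proof eventually_elim
    case (elim \<omega>)
    show ?case
    proof
      fix T
      obtain t where t: "t \<ge> T" "?Q2 (traj f U0 \<omega> t) (stake 1 (sdrop t \<omega>))"
        using elim unfolding traj_eq_foldl by blast
      then have "?nonorth (traj f U0 \<omega> t) \<or> ?nonorth (traj f U0 \<omega> (t + 1))"
        using is_config_traj[OF f U0] linked_traj[OF f U0 linked] unfolding traj_add by blast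
      then show "\<exists>t\<ge>T. ?nonorth (traj f U0 \<omega> t)"
        using t(1) trans_le_add1[OF t(1), of 1] by blast
    qed
  qed
  \<comment> \<open>Here the target word does not depend on the state. The countable intersection
    over \<open>K\<close> comes afterwards because the \<open>K\<close> needed varies with
    \<open>\<omega>\<close>.\<close>
  have "AE \<omega> in stream_space (measure_pmf D).
      \<forall>T. \<exists>t\<ge>T. stake (K + K) (sdrop t \<omega>) = replicate K (1, 3) @ replicate K (2, 3)" for K
  proof (rule AE_state_word_frequently[of D "K + K" "\<lambda>_ w. w = replicate K (1, 3) @ replicate K (2, 3)"])
    show "\<exists>w. set w \<subseteq> set_pmf D \<and> length w = K + K \<and> w = replicate K (1, 3) @ replicate K (2, 3)"
      using supp[of 1 3] supp[of 2 3] by (auto simp: set_replicate_conv_if)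
  qed
  then have Q3: "AE \<omega> in stream_space (measure_pmf D).
      \<forall>K T. \<exists>t\<ge>T. stake (K + K) (sdrop t \<omega>) = replicate K (1, 3) @ replicate K (2, 3)"
    by (subst AE_all_countable) blast
  from Q1 Q2 Q3 show ?thesis
  proof eventually_elim
    case (elim \<omega>)
    then show ?case
      using polarizes_if_words_occur[OF f U0 linked] by blast
  qed
qed

end
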